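(* Let $R$ be a ring and let $M=\bigoplus_{i=1}^nM_i$ be a direct sum of Euclidean $R$-modules. Suppose that $A\in M_{m,n}(M_1,\ldots,M_n)$ and $A'\in M_{m',n}(M_1,\ldots,M_n)$. Then $A\sim_sA'$ if and only if $N(A)=N(A')$.
   Context: Rings are unital and modules are left modules. A poset is Artinian if every descending chain in it stabilizes. An $R$-module $E$ is a Euclidean module if there is a function $d_E:E\setminus\{0\}\to P$ to a poset $(P,\ge)$ such that the poset $\mathrm{im}(d_E)$ is Artinian and, for any nonzero $u,v\in E$, there are $q\in R$ and $r\in E$ with $u=qv+r$ and either $r=0$ or $d_E(r)<d_E(v)$. $M_{m,n}(M_1,\ldots,M_n)$ is the set of $m\times n$ matrices $(a_{ij})$ with $a_{ij}\in M_j$; the rows $a_i$ are elements of $M$, and $N(A):=\sum_iRa_i$. Elementary row operations: (ER1) $a_i\mapsto a_i+\sum_{j\neq i}r_ja_j$ with $r_j\in R$; (ER2) swapping two rows; (ER0) replacing a zero row by $\sum_ir_ia_i$ with $r_i\in R$. Matrices are considered up to adding or deleting zero rows (so (ER0) amounts to adjoining a new row $\sum_ir_ia_i$). $A\sim_sA'$ (strongly left-row equivalent; the numbers of rows may differ) means one matrix is obtained from the other by finitely many operations (ER0), (ER1), (ER2). *)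

theory Defs
  imports "HOL-Algebra.Module"
begin

text \<open>
  The library locale \<open>module\<close> requires a commutative ring of scalars; this is the same set of
  axioms over an arbitrary unital ring.
\<close>

locale left_module = R?: ring R + M?: abelian_group M
    for R (structure) and M (structure) +
  assumes smult_closed:
      "\<lbrakk>a \<in> carrier R; x \<in> carrier M\<rbrakk> \<Longrightarrow> a \<odot>\<^bsub>M\<^esub> x \<in> carrier M"
    and smult_l_distr:
      "\<lbrakk>a \<in> carrier R; b \<in> carrier R; x \<in> carrier M\<rbrakk> \<Longrightarrow>
        (a \<oplus>\<^bsub>R\<^esub> b) \<odot>\<^bsub>M\<^esub> x = a \<odot>\<^bsub>M\<^esub> x \<oplus>\<^bsub>M\<^esub> b \<odot>\<^bsub>M\<^esub> x"
    and smult_r_distr: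
      "\<lbrakk>a \<in> carrier R; x \<in> carrier M; y \<in> carrier M\<rbrakk> \<Longrightarrow>
        a \<odot>\<^bsub>M\<^esub> (x \<oplus>\<^bsub>M\<^esub> y) = a \<odot>\<^bsub>M\<^esub> x \<oplus>\<^bsub>M\<^esub> a \<odot>\<^bsub>M\<^esub> y"
    and smult_assoc1:
      "\<lbrakk>a \<in> carrier R; b \<in> carrier R; x \<in> carrier M\<rbrakk> \<Longrightarrow>
        (a \<otimes>\<^bsub>R\<^esub> b) \<odot>\<^bsub>M\<^esub> x = a \<odot>\<^bsub>M\<^esub> (b \<odot>\<^bsub>M\<^esub> x)"
    and smult_one:
      "x \<in> carrier M \<Longrightarrow> \<one>\<^bsub>R\<^esub> \<odot>\<^bsub>M\<^esub> x = x"

definition artinian_poset :: "'p gorder \<Rightarrow> bool" where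
  "artinian_poset P \<longleftrightarrow> partial_order P \<and>
     (\<forall>c :: nat \<Rightarrow> 'p. (\<forall>k. c k \<in> carrier P) \<and> (\<forall>k. c (Suc k) \<sqsubseteq>\<^bsub>P\<^esub> c k) \<longrightarrow>
        (\<exists>N. \<forall>k\<ge>N. c k = c N))"

text \<open>
  One cannot quantify over types inside a formula, so the type \<open>'p\<close> in which the poset lives is a
  parameter.  The poset itself (carrier and order) is existentially quantified, and the
  carrier may be any subset of \<open>'p\<close>.
\<close>

definition euclidean_module ::
    "'p itself \<Rightarrow> ('a, 'r) ring_scheme \<Rightarrow> ('a, 'b, 'm) module_scheme \<Rightarrow> bool" where
  "euclidean_module T R E \<longleftrightarrow> left_module R E \<and>
     (\<exists>(P :: 'p gorder) d.
        partial_order P \<and>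
        d \<in> carrier E - {\<zero>\<^bsub>E\<^esub>} \<rightarrow> carrier P \<and>
        artinian_poset (P\<lparr>carrier := d ` (carrier E - {\<zero>\<^bsub>E\<^esub>})\<rparr>) \<and>
        (\<forall>u \<in> carrier E - {\<zero>\<^bsub>E\<^esub>}. \<forall>v \<in> carrier E - {\<zero>\<^bsub>E\<^esub>}.
           \<exists>q \<in> carrier R. \<exists>r \<in> carrier E.
             u = q \<odot>\<^bsub>E\<^esub> v \<oplus>\<^bsub>E\<^esub> r \<and> (r = \<zero>\<^bsub>E\<^esub> \<or> d r \<sqsubset>\<^bsub>P\<^esub> d v)))"

text \<open>
  The direct sum of \<open>M 0, \<dots>, M (n - 1)\<close>: tuples are extensional functions on \<open>{..<n}\<close>.  The type
  of modules extends that of rings, and its fields \<open>mult\<close> and \<open>one\<close> have no meaning for a module.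
\<close>

definition direct_sum ::
    "nat \<Rightarrow> (nat \<Rightarrow> ('a, 'b, 'm) module_scheme) \<Rightarrow> ('a, nat \<Rightarrow> 'b) module" where
  "direct_sum n M =
     \<lparr>carrier = (\<Pi>\<^sub>E j\<in>{..<n}. carrier (M j)),
      mult = undefined,
      one = undefined,
      zero = (\<lambda>j\<in>{..<n}. \<zero>\<^bsub>M j\<^esub>),
      add = (\<lambda>x y. \<lambda>j\<in>{..<n}. x j \<oplus>\<^bsub>M j\<^esub> y j),
      smult = (\<lambda>r x. \<lambda>j\<in>{..<n}. r \<odot>\<^bsub>M j\<^esub> x j)\<rparr>"

text \<open>
  A matrix is the list of its rows, each row being an element of the direct sum; the entry in
  row \<open>i\<close> and column \<open>j\<close> of \<open>A\<close> is \<open>(A ! i) j\<close>, an element of \<open>M j\<close>.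
\<close>

definition matrices ::
    "nat \<Rightarrow> nat \<Rightarrow> (nat \<Rightarrow> ('a, 'b, 'm) module_scheme) \<Rightarrow> (nat \<Rightarrow> 'b) list set" where
  "matrices m n M = {A. length A = m \<and> set A \<subseteq> carrier (direct_sum n M)}"

definition row_module ::
    "('a, 'r) ring_scheme \<Rightarrow> ('a, 'c, 'm) module_scheme \<Rightarrow> 'c list \<Rightarrow> 'c set" where
  "row_module R V A =
     {\<Oplus>\<^bsub>V\<^esub>i\<in>{..<length A}. r i \<odot>\<^bsub>V\<^esub> A ! i | r. r \<in> {..<length A} \<rightarrow> carrier R}"

text \<open>
  The rules \<open>add_zero_row\<close> and \<open>del_zero_row\<close> express that matrices are considered up to zero rows.
\<close>

inductive row_operation ::
    "('a, 'r) ring_scheme \<Rightarrow> ('a, 'c, 'm) module_scheme \<Rightarrow> 'c list \<Rightarrow> 'c list \<Rightarrow> bool"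
  for R V where
  ER0: "\<lbrakk>i < length A; A ! i = \<zero>\<^bsub>V\<^esub>; r \<in> {..<length A} \<rightarrow> carrier R\<rbrakk> \<Longrightarrow>
      row_operation R V A (A[i := (\<Oplus>\<^bsub>V\<^esub>j\<in>{..<length A}. r j \<odot>\<^bsub>V\<^esub> A ! j)])"
| ER1: "\<lbrakk>i < length A; r \<in> {..<length A} - {i} \<rightarrow> carrier R\<rbrakk> \<Longrightarrow>
      row_operation R V A (A[i := A ! i \<oplus>\<^bsub>V\<^esub> (\<Oplus>\<^bsub>V\<^esub>j\<in>{..<length A} - {i}. r j \<odot>\<^bsub>V\<^esub> A ! j)])"
| ER2: "\<lbrakk>i < length A; j < length A\<rbrakk> \<Longrightarrow>
      row_operation R V A (A[i := A ! j, j := A ! i])"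
| add_zero_row: "row_operation R V (B @ C) (B @ \<zero>\<^bsub>V\<^esub> # C)"
| del_zero_row: "row_operation R V (B @ \<zero>\<^bsub>V\<^esub> # C) (B @ C)"

text \<open>
  For rows in a left module every operation can be undone by further operations, so it does not
  matter which of the two matrices is obtained from the other.
\<close>

definition strongly_row_equivalent ::
    "('a, 'r) ring_scheme \<Rightarrow> ('a, 'c, 'm) module_scheme \<Rightarrow> 'c list \<Rightarrow> 'c list \<Rightarrow> bool" where
  "strongly_row_equivalent R V = (row_operation R V)\<^sup>*\<^sup>*"

end

theory Submission
  imports Defs "HOL.Hull"
begin

text \<open>
  Both row modules are spans of the rows, and every row operation preserves the span.  Conversely,
  if the spans agree, then adjoining the rows of \<open>A'\<close> to \<open>A\<close> one by one, and afterwards deleting the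
  rows of \<open>A\<close> one by one, gives \<open>A \<sim> A @ A' \<sim> A'\<close>: each row that is adjoined or deleted is
  a linear combination of the others.
\<close>

section \<open>Row indices and sets of rows\<close>

lemma nth_image_lessThan: "(!) xs ` {..<length xs} = set xs"
  by (auto simp: set_conv_nth)

text \<open>The sum in \<open>ER1\<close> runs over the indices of all rows but one. Its range of
  indices splits into the positions before that row and, shifted by \<open>Suc (length B)\<close>,
  those after it, so the remaining rows are described without indices.\<close>

lemma nth_image_other_rows: "(!) (B @ x # C) ` ({..<length (B @ x # C)} - {length B}) = set (B @ C)"
proof -
  have "{..<length (B @ x # C)} - {length B}
      = {..<length B} \<union> (\<lambda>i. Suc (length B + i)) ` {..<length C}" (is "?L = ?R")
  proof
    show "?L \<subseteq> ?R"
    proof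
      fix i assume "i \<in> ?L"
      then show "i \<in> ?R"
        by (cases "i < length B") (auto intro!: image_eqI[of _ _ "i - Suc (length B)"])
    qed
  qed auto
  moreover have "(!) (B @ x # C) ` {..<length B} = (!) B ` {..<length B}"
    by (intro image_cong) (auto simp: nth_append)
  moreover have "(!) (B @ x # C) ` (\<lambda>i. Suc (length B + i)) ` {..<length C} = (!) C ` {..<length C}"
    unfolding image_image by (intro image_cong) (auto simp: nth_append)
  ultimately show ?thesis
    by (simp only: image_Un nth_image_lessThan set_append)
qed

section \<open>Spans in a left module\<close>

context left_module
begin

text \<open>The span is the intersection of all submodules containing \<open>S\<close>. The
  predicate \<open>submodule\<close> asks only for an additive subgroup closed under scalars, so it
  makes sense over a noncommutative ring.\<close>

abbreviation span :: "'c set \<Rightarrow> 'c set" where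
  "span S \<equiv> (\<lambda>H. submodule H R M) hull S"

lemma smult_zero_left: "x \<in> carrier M \<Longrightarrow> \<zero>\<^bsub>R\<^esub> \<odot>\<^bsub>M\<^esub> x = \<zero>\<^bsub>M\<^esub>"
  using smult_l_distr[of "\<zero>\<^bsub>R\<^esub>" "\<zero>\<^bsub>R\<^esub>" x] by (simp add: smult_closed)

lemma smult_zero_right: "a \<in> carrier R \<Longrightarrow> a \<odot>\<^bsub>M\<^esub> \<zero>\<^bsub>M\<^esub> = \<zero>\<^bsub>M\<^esub>"
  using smult_r_distr[of a "\<zero>\<^bsub>M\<^esub>" "\<zero>\<^bsub>M\<^esub>"] by (simp add: smult_closed)

text \<open>Negation is multiplication by the scalar -1, so closure under negatives follows from
  closure under scalars.\<close>

lemma submodule_iff: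
  "submodule H R M \<longleftrightarrow> H \<subseteq> carrier M \<and> \<zero>\<^bsub>M\<^esub> \<in> H \<and>
     (\<forall>x\<in>H. \<forall>y\<in>H. x \<oplus>\<^bsub>M\<^esub> y \<in> H) \<and> (\<forall>a\<in>carrier R. \<forall>x\<in>H. a \<odot>\<^bsub>M\<^esub> x \<in> H)"
  (is "_ \<longleftrightarrow> ?closed")
proof
  assume "submodule H R M"
  then interpret submodule H R M .
  show ?closed
    using subset one_closed m_closed by auto
next
  assume closed: ?closed
  have "\<ominus>\<^bsub>M\<^esub> x \<in> H" if "x \<in> H" for x
  proof -
    have x: "x \<in> carrier M" using that closed by auto
    have "\<ominus>\<^bsub>R\<^esub> \<one>\<^bsub>R\<^esub> \<odot>\<^bsub>M\<^esub> x \<oplus>\<^bsub>M\<^esub> x = (\<ominus>\<^bsub>R\<^esub> \<one>\<^bsub>R\<^esub> \<oplus>\<^bsub>R\<^esub> \<one>\<^bsub>R\<^esub>) \<odot>\<^bsub>M\<^esub> x"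
      using x by (simp add: smult_l_distr smult_one)
    also have "\<dots> = \<zero>\<^bsub>M\<^esub>"
      using x by (simp add: R.l_neg smult_zero_left)
    finally have "\<ominus>\<^bsub>M\<^esub> x = \<ominus>\<^bsub>R\<^esub> \<one>\<^bsub>R\<^esub> \<odot>\<^bsub>M\<^esub> x"
      using x by (intro M.minus_equality) (auto simp: smult_closed)
    then show ?thesis
      using closed that by simp
  qed
  then show "submodule H R M"
    using closed
    by (intro submodule.intro M.add.subgroupI submodule_axioms.intro) auto
qed

lemma smult_finsum:
  assumes "a \<in> carrier R" "f \<in> I \<rightarrow> carrier M"
  shows "a \<odot>\<^bsub>M\<^esub> (\<Oplus>\<^bsub>M\<^esub>i\<in>I. f i) = (\<Oplus>\<^bsub>M\<^esub>i\<in>I. a \<odot>\<^bsub>M\<^esub> f i)"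
  using assms(2)
proof (induction I rule: infinite_finite_induct)
  case (insert i I)
  then have "(\<lambda>i. a \<odot>\<^bsub>M\<^esub> f i) \<in> I \<rightarrow> carrier M"
    using assms(1) by (simp add: smult_closed Pi_iff)
  with insert show ?case
    using assms(1) by (simp add: M.finsum_insert smult_r_distr smult_closed Pi_iff M.finsum_closed)
\<comment> \<open>The cases left are the empty index set and an infinite one; in both
  \<open>finsum\<close> is zero, for infinite sets by convention.\<close>
qed (use assms(1) in \<open>simp_all add: smult_zero_right M.finsum_infinite M.finsum_empty\<close>)

lemma finsum_in_submodule:
  assumes "submodule H R M" "f \<in> I \<rightarrow> H"
  shows "(\<Oplus>\<^bsub>M\<^esub>i\<in>I. f i) \<in> H"
  using assms(2)
proof (induction I rule: infinite_finite_induct)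
  case (insert i I)
  then have "f \<in> I \<rightarrow> carrier M" "f i \<in> carrier M"
    using assms(1) by (auto simp: submodule_iff)
  with insert show ?case
    using assms(1) by (simp add: M.finsum_insert submodule_iff)
qed (use assms(1) in \<open>simp_all add: submodule_iff M.finsum_infinite\<close>)

text \<open>The closure conditions pass to intersections, and \<open>carrier M\<close> is itself one
  of the submodules intersected, which keeps the intersection inside
  \<open>carrier M\<close>.\<close>

lemma submodule_span:
  assumes "S \<subseteq> carrier M"
  shows "submodule (span S) R M"
proof -
  have "submodule (carrier M) R M"
    by (auto simp: submodule_iff smult_closed)
  with assms show ?thesis
    unfolding submodule_iff hull_def by auto
qed

lemma span_subset_carrier: "S \<subseteq> carrier M \<Longrightarrow> span S \<subseteq> carrier M"
  using submodule_span[of S] by (simp add: submodule_iff)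

lemma span_minus:
  assumes "S \<subseteq> carrier M" "y \<in> span S"
  shows "\<ominus>\<^bsub>M\<^esub> y \<in> span S"
  using submodule_span[OF assms(1)] assms(2) subgroup.m_inv_closed
  unfolding submodule_def a_inv_def by fastforce

lemma span_insert:
  assumes "S \<subseteq> carrier M" "y \<in> span S"
  shows "span (insert y S) = span S"
proof
  show "span (insert y S) \<subseteq> span S"
    using assms by (intro hull_minimal submodule_span) (auto intro: hull_inc)
qed (auto intro!: hull_mono)

text \<open>Adding \<open>y\<close> is undone by adding its negative, which also lies in the span of
  \<open>S\<close>. This is the invariance behind \<open>ER1\<close>.\<close>

lemma span_insert_add:
  assumes "S \<subseteq> carrier M" "x \<in> carrier M" "y \<in> span S"
  shows "span (insert (x \<oplus>\<^bsub>M\<^esub> y) S) = span (insert x S)"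
proof -
  have y: "y \<in> carrier M"
    using assms span_subset_carrier by auto
  have neg_y: "\<ominus>\<^bsub>M\<^esub> y \<in> span S"
    using assms by (intro span_minus)
  \<comment> \<open>Stated for arbitrary \<open>u\<close> and \<open>v\<close> so that it yields
    both inclusions: once for \<open>x\<close> and \<open>y\<close>, once for the sum of
    \<open>x\<close> and \<open>y\<close> and the negative of \<open>y\<close>.\<close>
  have le: "span (insert (u \<oplus>\<^bsub>M\<^esub> v) S) \<subseteq> span (insert u S)"
    if "u \<in> carrier M" "v \<in> span S" for u v
  proof (rule hull_minimal)
    show sub: "submodule (span (insert u S)) R M"
      using assms(1) that by (intro submodule_span) auto
    have "u \<in> span (insert u S)" "v \<in> span (insert u S)"
      using that hull_mono[of S "insert u S"] by (auto intro: hull_inc)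
    then show "insert (u \<oplus>\<^bsub>M\<^esub> v) S \<subseteq> span (insert u S)"
      using sub by (auto simp: submodule_iff intro: hull_inc)
  qed
  have "x \<oplus>\<^bsub>M\<^esub> y \<oplus>\<^bsub>M\<^esub> \<ominus>\<^bsub>M\<^esub> y = x"
    using assms(2) y by (simp add: M.a_assoc M.r_neg)
  then show ?thesis
    using le[of x y] le[of "x \<oplus>\<^bsub>M\<^esub> y" "\<ominus>\<^bsub>M\<^esub> y"] assms neg_y y by auto
qed

text \<open>The linear combinations form a submodule containing every \<open>f i\<close>, and a
  submodule containing every \<open>f i\<close> contains them all. Indexing by \<open>I\<close>
  allows repeated rows, and covers the sums over all rows as well as those that omit one.\<close>

lemma span_image:
  assumes fin: "finite I" and f: "f \<in> I \<rightarrow> carrier M"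
  shows "span (f ` I) = {\<Oplus>\<^bsub>M\<^esub>i\<in>I. r i \<odot>\<^bsub>M\<^esub> f i | r. r \<in> I \<rightarrow> carrier R}" (is "_ = ?C")
proof
  have closed: "(\<lambda>i. r i \<odot>\<^bsub>M\<^esub> f i) \<in> I \<rightarrow> carrier M" if "r \<in> I \<rightarrow> carrier R" for r
    using that f by (simp add: smult_closed Pi_iff)
  show "span (f ` I) \<subseteq> ?C"
  proof (rule hull_minimal)
    show "f ` I \<subseteq> ?C"
    proof safe
      fix i assume i: "i \<in> I"
      \<comment> \<open>The coefficients are those of a unit vector: one at \<open>i\<close>, zero
        elsewhere.\<close>
      have "(\<Oplus>\<^bsub>M\<^esub>j\<in>I. (if j = i then \<one>\<^bsub>R\<^esub> else \<zero>\<^bsub>R\<^esub>) \<odot>\<^bsub>M\<^esub> f j)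
          = (\<Oplus>\<^bsub>M\<^esub>j\<in>I. if i = j then f j else \<zero>\<^bsub>M\<^esub>)"
        using f by (intro M.finsum_cong') (auto simp: smult_one smult_zero_left Pi_iff)
      also have "\<dots> = f i"
        using i fin f by (simp add: M.finsum_singleton)
      finally show "\<exists>r. f i = (\<Oplus>\<^bsub>M\<^esub>j\<in>I. r j \<odot>\<^bsub>M\<^esub> f j) \<and> r \<in> I \<rightarrow> carrier R"
        by (intro exI[of _ "\<lambda>j. if j = i then \<one>\<^bsub>R\<^esub> else \<zero>\<^bsub>R\<^esub>"]) auto
    qed
    show "submodule ?C R M"
      unfolding submodule_iff
    proof (intro conjI ballI)
      show "?C \<subseteq> carrier M"
        using closed by (auto intro!: M.finsum_closed)
      have "(\<Oplus>\<^bsub>M\<^esub>j\<in>I. \<zero>\<^bsub>R\<^esub> \<odot>\<^bsub>M\<^esub> f j) = (\<Oplus>\<^bsub>M\<^esub>j\<in>I. \<zero>\<^bsub>M\<^esub>)"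
        using f by (intro M.finsum_cong') (auto simp: smult_zero_left Pi_iff)
      then show "\<zero>\<^bsub>M\<^esub> \<in> ?C"
        by (auto simp: M.finsum_zero intro!: exI[of _ "\<lambda>j. \<zero>\<^bsub>R\<^esub>"])
    next
      fix x y assume "x \<in> ?C" "y \<in> ?C"
      then obtain r s where rs: "r \<in> I \<rightarrow> carrier R" "s \<in> I \<rightarrow> carrier R"
        and xy: "x = (\<Oplus>\<^bsub>M\<^esub>i\<in>I. r i \<odot>\<^bsub>M\<^esub> f i)" "y = (\<Oplus>\<^bsub>M\<^esub>i\<in>I. s i \<odot>\<^bsub>M\<^esub> f i)"
        by auto
      have "x \<oplus>\<^bsub>M\<^esub> y = (\<Oplus>\<^bsub>M\<^esub>i\<in>I. r i \<odot>\<^bsub>M\<^esub> f i \<oplus>\<^bsub>M\<^esub> s i \<odot>\<^bsub>M\<^esub> f i)"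
        using rs closed unfolding xy by (simp add: M.finsum_addf)
      also have "\<dots> = (\<Oplus>\<^bsub>M\<^esub>i\<in>I. (r i \<oplus>\<^bsub>R\<^esub> s i) \<odot>\<^bsub>M\<^esub> f i)"
        using rs f by (intro M.finsum_cong') (auto simp: smult_l_distr smult_closed Pi_iff)
      finally show "x \<oplus>\<^bsub>M\<^esub> y \<in> ?C"
        using rs by (auto intro!: exI[of _ "\<lambda>i. r i \<oplus>\<^bsub>R\<^esub> s i"])
    next
      fix a x assume a: "a \<in> carrier R" and "x \<in> ?C"
      then obtain r where r: "r \<in> I \<rightarrow> carrier R" and x: "x = (\<Oplus>\<^bsub>M\<^esub>i\<in>I. r i \<odot>\<^bsub>M\<^esub> f i)"
        by auto
      have "a \<odot>\<^bsub>M\<^esub> x = (\<Oplus>\<^bsub>M\<^esub>i\<in>I. a \<odot>\<^bsub>M\<^esub> (r i \<odot>\<^bsub>M\<^esub> f i))"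
        using a r closed unfolding x by (simp add: smult_finsum)
      also have "\<dots> = (\<Oplus>\<^bsub>M\<^esub>i\<in>I. (a \<otimes>\<^bsub>R\<^esub> r i) \<odot>\<^bsub>M\<^esub> f i)"
        using a r f by (intro M.finsum_cong') (auto simp: smult_assoc1 smult_closed Pi_iff)
      finally show "a \<odot>\<^bsub>M\<^esub> x \<in> ?C"
        using a r by (auto intro!: exI[of _ "\<lambda>i. a \<otimes>\<^bsub>R\<^esub> r i"])
    qed
  qed
  have "submodule (span (f ` I)) R M"
    using f by (intro submodule_span) auto
  then show "?C \<subseteq> span (f ` I)"
    by (auto intro!: finsum_in_submodule submodule.smult_closed intro: hull_inc simp: Pi_iff)
qed

section \<open>Row operations preserve the row module\<close>

lemma row_module_eq_span:
  assumes "set A \<subseteq> carrier M"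
  shows "row_module R M A = span (set A)"
proof -
  have "(!) A \<in> {..<length A} \<rightarrow> carrier M"
    using assms by auto
  then show ?thesis
    using span_image[of "{..<length A}" "(!) A"] unfolding row_module_def
    by (simp add: nth_image_lessThan)
qed

text \<open>Up to order, each operation either keeps the rows, inserts or removes a redundant
  generator, or adds to one row an element of the span of the others. That the new rows stay in
  \<open>carrier M\<close> is included so that the lemma can be iterated along a chain of
  operations.\<close>

lemma row_operation_span:
  assumes "row_operation R M A B" "set A \<subseteq> carrier M"
  shows "set B \<subseteq> carrier M \<and> span (set B) = span (set A)"
  using assms
proof cases
  case (ER0 i r)
  define C D where "C = take i A" and "D = drop (Suc i) A"
  have A: "A = C @ \<zero>\<^bsub>M\<^esub> # D"
    using ER0 by (metis C_def D_def id_take_nth_drop)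
  have CD: "set (C @ D) \<subseteq> carrier M"
    using assms(2) A by auto
  define y where "y = (\<Oplus>\<^bsub>M\<^esub>j\<in>{..<length A}. r j \<odot>\<^bsub>M\<^esub> A ! j)"
  have B: "set B = insert y (set (C @ D))"
    using ER0 by (auto simp: y_def C_def D_def upd_conv_take_nth_drop)
  \<comment> \<open>The zero row contributes nothing to the span, so the combination
    \<open>y\<close> of all rows of \<open>A\<close> already lies in the span of the rows other than
    the one it replaces.\<close>
  have zero: "span (set A) = span (set (C @ D))"
    using span_insert[OF CD, of "\<zero>\<^bsub>M\<^esub>"] submodule_span[OF CD] A by (simp add: submodule_iff)
  have "y \<in> row_module R M A"
    unfolding row_module_def y_def using ER0 by blast
  then have "y \<in> span (set (C @ D))"
    using row_module_eq_span[OF assms(2)] zero by simp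
  then show ?thesis
    using span_insert[OF CD] span_subset_carrier[OF CD] zero CD B by auto
next
  case (ER1 i r)
  define C D where "C = take i A" and "D = drop (Suc i) A"
  have A: "A = C @ A ! i # D" and i: "i = length C"
    using ER1 by (auto simp: C_def D_def id_take_nth_drop)
  have CD: "set (C @ D) \<subseteq> carrier M" and Ai: "A ! i \<in> carrier M"
    using assms(2) ER1 by (auto simp: C_def D_def dest: in_set_takeD in_set_dropD)
  define y where "y = (\<Oplus>\<^bsub>M\<^esub>j\<in>{..<length A} - {i}. r j \<odot>\<^bsub>M\<^esub> A ! j)"
  have B: "set B = insert (A ! i \<oplus>\<^bsub>M\<^esub> y) (set (C @ D))"
    using ER1 by (auto simp: y_def C_def D_def upd_conv_take_nth_drop)
  \<comment> \<open>Since the sum \<open>y\<close> omits the index \<open>i\<close>, it lies in the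
    span of the other rows, as \<open>span_insert_add\<close> requires.\<close>
  have "(!) A \<in> {..<length A} - {i} \<rightarrow> carrier M"
    using assms(2) nth_mem by blast
  then have "y \<in> span ((!) A ` ({..<length A} - {i}))"
    using ER1 by (subst span_image) (auto simp: y_def)
  moreover have "(!) A ` ({..<length A} - {i}) = set (C @ D)"
    using nth_image_other_rows[of C "A ! i" D] A i by metis
  ultimately have y: "y \<in> span (set (C @ D))"
    by simp
  have "set A = insert (A ! i) (set (C @ D))"
    using A by (metis Un_insert_right list.simps(15) set_append)
  then show ?thesis
    using span_insert_add[OF CD Ai y] span_subset_carrier[OF CD] y Ai CD B by auto
next
  case (ER2 i j)
  then have "set B = set A"
    by simp
  then show ?thesis
    using assms(2) by simp
next
  case (add_zero_row C D)
  then show ?thesis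
    using assms(2) span_insert[of "set A" "\<zero>\<^bsub>M\<^esub>"] submodule_span[of "set A"]
    by (simp add: submodule_iff)
next
  case (del_zero_row C D)
  then show ?thesis
    using assms(2) span_insert[of "set B" "\<zero>\<^bsub>M\<^esub>"] submodule_span[of "set B"]
    by (simp add: submodule_iff)
qed

lemma strongly_row_equivalent_span:
  assumes "strongly_row_equivalent R M A B" "set A \<subseteq> carrier M"
  shows "set B \<subseteq> carrier M \<and> span (set B) = span (set A)"
  using assms(1) unfolding strongly_row_equivalent_def
proof induction
  case base
  then show ?case using assms(2) by simp
next
  case (step C D)
  then show ?case using row_operation_span[of C D] by simp
qed

section \<open>Adjoining and deleting redundant rows\<close>

lemma row_operation_add:
  assumes "set (B @ C) \<subseteq> carrier M" "x \<in> carrier M" "y \<in> span (set (B @ C))"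
  shows "row_operation R M (B @ x # C) (B @ (x \<oplus>\<^bsub>M\<^esub> y) # C)"
proof -
  let ?A = "B @ x # C" and ?i = "length B"
  let ?I = "{..<length ?A} - {?i}"
  have A: "set ?A \<subseteq> carrier M"
    using assms by auto
  have "(!) ?A \<in> ?I \<rightarrow> carrier M"
    using A nth_mem by blast
  moreover have "y \<in> span ((!) ?A ` ?I)"
    using assms(3) unfolding nth_image_other_rows .
  \<comment> \<open>Here \<open>span_image\<close> is read in the opposite direction: membership in
    the span of the other rows supplies the coefficients for \<open>ER1\<close>.\<close>
  ultimately obtain r where r: "r \<in> ?I \<rightarrow> carrier R" and "y = (\<Oplus>\<^bsub>M\<^esub>j\<in>?I. r j \<odot>\<^bsub>M\<^esub> ?A ! j)"
    by (subst (asm) span_image) auto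
  then show ?thesis
    using row_operation.ER1[of ?i ?A r R M] by simp
qed

text \<open>A zero row is adjoined first; then \<open>x\<close>, a combination of the other rows, is
  added to it.\<close>

lemma insert_row:
  assumes "set (B @ C) \<subseteq> carrier M" "x \<in> span (set (B @ C))"
  shows "strongly_row_equivalent R M (B @ C) (B @ x # C)"
proof -
  have "row_operation R M (B @ \<zero>\<^bsub>M\<^esub> # C) (B @ x # C)"
    using row_operation_add[of B C "\<zero>\<^bsub>M\<^esub>" x] assms span_subset_carrier[OF assms(1)]
    by auto
  then show ?thesis
    unfolding strongly_row_equivalent_def
    by (meson add_zero_row converse_rtranclp_into_rtranclp r_into_rtranclp)
qed

text \<open>Adding the negative of \<open>x\<close>, again a combination of the other rows, turns
  the row into zero, and a zero row may be deleted.\<close>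

lemma delete_row:
  assumes "set (B @ C) \<subseteq> carrier M" "x \<in> span (set (B @ C))"
  shows "strongly_row_equivalent R M (B @ x # C) (B @ C)"
proof -
  have x: "x \<in> carrier M"
    using assms span_subset_carrier by blast
  have "\<ominus>\<^bsub>M\<^esub> x \<in> span (set (B @ C))"
    using assms by (intro span_minus)
  then have "row_operation R M (B @ x # C) (B @ \<zero>\<^bsub>M\<^esub> # C)"
    using row_operation_add[of B C x "\<ominus>\<^bsub>M\<^esub> x"] assms x by (simp add: M.r_neg)
  then show ?thesis
    unfolding strongly_row_equivalent_def
    by (meson del_zero_row converse_rtranclp_into_rtranclp r_into_rtranclp)
qed

lemma strongly_row_equivalent_append:
  assumes "set A \<subseteq> carrier M" "set B \<subseteq> span (set A)"
  shows "strongly_row_equivalent R M A (A @ B)"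
  using assms(2)
\<comment> \<open>New rows are adjoined at the end, so the induction builds \<open>B\<close> from
  the right.\<close>
proof (induction B rule: rev_induct)
  case Nil
  then show ?case by (simp add: strongly_row_equivalent_def)
next
  case (snoc b B)
  have "set (A @ B) \<subseteq> carrier M"
    using snoc.prems assms(1) span_subset_carrier[OF assms(1)] by auto
  moreover have "b \<in> span (set (A @ B))"
    using snoc.prems hull_mono[of "set A" "set (A @ B)"] by auto
  ultimately have "strongly_row_equivalent R M (A @ B) (A @ B @ [b])"
    using insert_row[of "A @ B" "[]" b] by simp
  with snoc show ?case
    unfolding strongly_row_equivalent_def by (auto intro: rtranclp_trans)
qed

lemma append_strongly_row_equivalent:
  assumes "set B \<subseteq> carrier M" "set A \<subseteq> span (set B)"
  shows "strongly_row_equivalent R M (A @ B) B"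
  using assms(2)
\<comment> \<open>Rows are deleted from the front. All of \<open>B\<close> stays in place, so its
  span always contains the row being deleted.\<close>
proof (induction A)
  case Nil
  then show ?case by (simp add: strongly_row_equivalent_def)
next
  case (Cons a A)
  have "set (A @ B) \<subseteq> carrier M"
    using Cons.prems assms(1) span_subset_carrier[OF assms(1)] by auto
  moreover have "a \<in> span (set (A @ B))"
    using Cons.prems hull_mono[of "set B" "set (A @ B)"] by auto
  ultimately have "strongly_row_equivalent R M (a # A @ B) (A @ B)"
    using delete_row[of "[]" "A @ B" a] by simp
  with Cons show ?case
    unfolding strongly_row_equivalent_def by (auto intro: rtranclp_trans)
qed

theorem strongly_row_equivalent_iff_row_module_eq:
  assumes "set A \<subseteq> carrier M" "set B \<subseteq> carrier M"
  shows "strongly_row_equivalent R M A B \<longleftrightarrow> row_module R M A = row_module R M B"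
proof
  assume "strongly_row_equivalent R M A B"
  then have "span (set B) = span (set A)"
    using strongly_row_equivalent_span[of A B] assms(1) by simp
  then show "row_module R M A = row_module R M B"
    using assms by (simp add: row_module_eq_span)
next
  assume "row_module R M A = row_module R M B"
  then have "span (set A) = span (set B)"
    using assms by (simp add: row_module_eq_span)
  \<comment> \<open>Each set of rows lies in its own span, which is also the span of the other
    set.\<close>
  then have "set B \<subseteq> span (set A)" "set A \<subseteq> span (set B)"
    using hull_subset by fast+
  \<comment> \<open>The chain passes through \<open>A @ B\<close>: first the rows of
    \<open>B\<close> are appended, then those of \<open>A\<close> are deleted.\<close>
  then show "strongly_row_equivalent R M A B"
    using strongly_row_equivalent_append append_strongly_row_equivalent assms
    unfolding strongly_row_equivalent_def by (blast intro: rtranclp_trans)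
qed

end

section \<open>The direct sum as a left module\<close>

lemma left_module_direct_sum:
  assumes "ring R" and M: "\<And>j. j < n \<Longrightarrow> left_module R (M j)"
  shows "left_module R (direct_sum n M)"
proof -
  have group: "abelian_group (M j)" if "j < n" for j
    using M[OF that] by (simp add: left_module_def)
  note group_simps = abelian_groupE(1,2,3,5)[OF group] and commute = abelian_groupE(4)[OF group]
  have "abelian_group (direct_sum n M)"
  proof (rule abelian_groupI, goal_cases)
    case (3 x y z)
    then show ?case
      by (auto simp: direct_sum_def PiE_iff group_simps fun_eq_iff)
  next
    case (4 x y)
    then show ?case
      by (auto simp: direct_sum_def PiE_iff commute fun_eq_iff)
  next
    \<comment> \<open>This law, like the one for the scalar one below, compares a restricted
      function with \<open>x\<close> itself, so extensionality is needed to get equality outside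
      \<open>{..<n}\<close>.\<close>
    case (5 x)
    then show ?case
      by (auto simp: direct_sum_def PiE_iff group_simps extensional_def fun_eq_iff)
  next
    case (6 x)
    then show ?case
      by (intro bexI[of _ "\<lambda>j\<in>{..<n}. \<ominus>\<^bsub>M j\<^esub> x j"])
        (auto simp: direct_sum_def PiE_iff group abelian_group.l_neg abelian_group.a_inv_closed)
  qed (auto simp: direct_sum_def PiE_iff group_simps)
  then show ?thesis
  proof (intro left_module.intro left_module_axioms.intro, goal_cases)
    case 3
    then show ?case
      using left_module.smult_closed[OF M] by (auto simp: direct_sum_def PiE_iff)
  next
    case 4
    then show ?case
      using left_module.smult_l_distr[OF M] by (auto simp: direct_sum_def PiE_iff)
  next
    case 5
    then show ?case
      using left_module.smult_r_distr[OF M] by (auto simp: direct_sum_def PiE_iff)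
  next
    case 6
    then show ?case
      using left_module.smult_assoc1[OF M] left_module.smult_closed[OF M]
      by (auto simp: direct_sum_def PiE_iff)
  next
    case 7
    then show ?case
      using left_module.smult_one[OF M]
      by (auto simp: direct_sum_def PiE_iff extensional_def fun_eq_iff)
  qed (use assms in auto)
qed

theorem theorem4p9:
  fixes R :: "('a, 'r) ring_scheme"
    and M :: "nat \<Rightarrow> ('a, 'b, 'm) module_scheme"
    and n m m' :: nat
    and A A' :: "(nat \<Rightarrow> 'b) list"
  assumes "ring R"
    and "\<And>i. i < n \<Longrightarrow> euclidean_module TYPE('p) R (M i)"
    and "A \<in> matrices m n M"
    and "A' \<in> matrices m' n M"
  shows "strongly_row_equivalent R (direct_sum n M) A A' \<longleftrightarrow>
      row_module R (direct_sum n M) A = row_module R (direct_sum n M) A'"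
proof (rule left_module.strongly_row_equivalent_iff_row_module_eq)
  \<comment> \<open>Each Euclidean summand is a left module by definition, so the general
    equivalence applies to lists of rows in the direct sum.\<close>
  show "left_module R (direct_sum n M)"
    using assms by (intro left_module_direct_sum) (auto simp: euclidean_module_def)
qed (use assms in \<open>auto simp: matrices_def\<close>)

end
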